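(* Let $P$ be a poset such that $A'=\operatorname{cl}_\sigma(A)$ for every subset $A\subseteq P$. Then for each $x\in P$, $\operatorname{int}_\sigma(\mathord{\uparrow}x)=\{y\in P\mid x\ll y\}$.
   Context: $\mathord{\downarrow}X=\{z\mid \exists y\in X,\ z\le y\}$, $\mathord{\uparrow}x=\{z\mid x\le z\}$. A subset is directed if nonempty and every finite subset has an upper bound in it. For $A\subseteq P$, $A'=\{x\in P\mid x=\bigvee D \text{ for some directed } D\subseteq\mathord{\downarrow}A\}$. $x\ll y$ iff for every directed $D\subseteq P$ whose supremum exists with $\bigvee D\ge y$, there is $d\in D$ with $x\le d$. A set $U$ is Scott open if it is an upper set and whenever $D$ is directed with $\bigvee D$ existing and in $U$, then $D\cap U\ne\emptyset$; $\operatorname{int}_\sigma$, $\operatorname{cl}_\sigma$ denote Scott interior and closure. *)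

theory Defs
  imports "HOL-Analysis.Abstract_Topology" "HOL-Library.Lub_Glb"
begin

abbreviation is_sup :: "'a::order set \<Rightarrow> 'a \<Rightarrow> bool" where
  "is_sup D s \<equiv> isLub UNIV D s"

lemma is_sup_iff: "is_sup D s \<longleftrightarrow> (\<forall>d\<in>D. d \<le> s) \<and> (\<forall>u. (\<forall>d\<in>D. d \<le> u) \<longrightarrow> s \<le> u)"
  by (auto simp: isLub_def leastP_def isUb_def setle_def setge_def)

definition directed_set :: "'a::order set \<Rightarrow> bool" where
  "directed_set D \<longleftrightarrow> D \<noteq> {} \<and> (\<forall>F. finite F \<and> F \<subseteq> D \<longrightarrow> (\<exists>u\<in>D. \<forall>x\<in>F. x \<le> u))"

definition down :: "'a::order set \<Rightarrow> 'a set" where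
  "down X = {z. \<exists>y\<in>X. z \<le> y}"

text \<open>The set $A'$. Suprema are taken in the whole type and need not exist, hence the relation
  \<^term>\<open>is_sup\<close> in place of an operator \<open>Sup\<close>.\<close>

definition dsup_closure :: "'a::order set \<Rightarrow> 'a set" where
  "dsup_closure A = {x. \<exists>D. directed_set D \<and> D \<subseteq> down A \<and> is_sup D x}"

definition way_below :: "'a::order \<Rightarrow> 'a \<Rightarrow> bool" where
  "way_below x y \<longleftrightarrow> (\<forall>D s. directed_set D \<and> is_sup D s \<and> y \<le> s \<longrightarrow> (\<exists>d\<in>D. x \<le> d))"

definition scott_open :: "'a::order set \<Rightarrow> bool" where
  "scott_open U \<longleftrightarrow>
     (\<forall>x y. x \<in> U \<and> x \<le> y \<longrightarrow> y \<in> U) \<and>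
     (\<forall>D s. directed_set D \<and> is_sup D s \<and> s \<in> U \<longrightarrow> D \<inter> U \<noteq> {})"

lemma istopology_scott_open: "istopology (scott_open :: 'a::order set \<Rightarrow> bool)"
  unfolding istopology_def
proof (intro conjI allI impI)
  fix S T :: "'a set"
  assume S: "scott_open S" and T: "scott_open T"
  show "scott_open (S \<inter> T)"
    unfolding scott_open_def
  proof (intro conjI allI impI)
    fix x y
    assume "x \<in> S \<inter> T \<and> x \<le> y"
    with S T show "y \<in> S \<inter> T" unfolding scott_open_def by blast
  next
    fix D s
    assume D: "directed_set D \<and> is_sup D s \<and> s \<in> S \<inter> T"
    obtain d e where de: "d \<in> D" "d \<in> S" "e \<in> D" "e \<in> T"
      using S T D unfolding scott_open_def by blast
    have "finite {d, e}" "{d, e} \<subseteq> D" using de by auto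
    then obtain u where "u \<in> D" "\<forall>x\<in>{d, e}. x \<le> u"
      using D unfolding directed_set_def by meson
    then have "u \<in> D" "u \<in> S" "u \<in> T"
      using S T de unfolding scott_open_def by auto
    then show "D \<inter> (S \<inter> T) \<noteq> {}" by blast
  qed
next
  fix K :: "'a set set"
  assume "\<forall>S\<in>K. scott_open S"
  then show "scott_open (\<Union>K)"
    unfolding scott_open_def by blast
qed

definition scott_topology :: "'a::order topology" where
  "scott_topology = topology scott_open"

lemma openin_scott_topology [simp]: "openin scott_topology U \<longleftrightarrow> scott_open U"
  by (simp add: scott_topology_def istopology_scott_open)

lemma topspace_scott_topology [simp]: "topspace (scott_topology :: 'a::order topology) = UNIV"
proof -
  have "scott_open (UNIV :: 'a set)"
    by (auto simp: scott_open_def directed_set_def)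
  then show ?thesis
    by (metis openin_scott_topology openin_subset top.extremum_uniqueI)
qed

end

theory Submission
  imports Defs
begin

text \<open>The interior of \<open>{x..}\<close> is the complement of the closure of
  \<open>- {x..}\<close>. By hypothesis that closure consists of the suprema of directed subsets of
  \<open>- {x..}\<close>, which is already a lower set. If \<open>x\<close> is way below
  \<open>y\<close>, then \<open>y\<close> is no such supremum, so it is interior.\<close>

lemma down_Compl_atLeast [simp]: "down (- {x..}) = - {x..}"
  by (auto simp: down_def dest: order_trans)

text \<open>This inclusion holds in every poset: a Scott open \<open>U\<close> inside
  \<open>{x..}\<close> containing \<open>y\<close> also contains any \<open>s\<close> above
  \<open>y\<close>, so it meets each directed set with supremum \<open>s\<close>.\<close>

lemma way_below_if_interior:
  assumes "y \<in> scott_topology interior_of {x..}"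
  shows "way_below x y"
proof -
  obtain U where U: "scott_open U" "U \<subseteq> {x..}" "y \<in> U"
    using assms by (auto simp: interior_of_def)
  show ?thesis
    unfolding way_below_def
  proof (intro allI impI, elim conjE)
    fix D s
    assume "directed_set D" "is_sup D s" "y \<le> s"
    with U have "D \<inter> U \<noteq> {}"
      unfolding scott_open_def by metis
    with U show "\<exists>d\<in>D. x \<le> d"
      by auto
  qed
qed

theorem theorem5p9:
  fixes x :: "'a::order"
  assumes "\<And>A :: 'a set. dsup_closure A = scott_topology closure_of A"
  shows "scott_topology interior_of {x..} = {y. way_below x y}"
proof (intro subset_antisym subsetI)
  fix y
  assume "y \<in> {y. way_below x y}"
  \<comment> \<open>A directed set with supremum exactly \<open>y\<close> has a member above
    \<open>x\<close>, so it cannot avoid \<open>{x..}\<close>.\<close>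
  then have "y \<notin> dsup_closure (- {x..})"
    by (fastforce simp: way_below_def dsup_closure_def)
  then show "y \<in> scott_topology interior_of {x..}"
    by (simp add: assms interior_of_closure_of Compl_eq_Diff_UNIV)
qed (use way_below_if_interior in blast)

end
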